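(* Suppose $0<\alpha\le\beta\le1$ (with $\alpha<1$). Over the parameter combinations for which $p_1^*$ and/or $p_2^*$ are well-defined (and with all other parameters held fixed): 1. $p_1^*$ is decreasing in $\gamma$ and increasing in $\Psi$. 2. $p_2^*$ is decreasing in $\lambda$, increasing in $\gamma$ and increasing in $\Psi$. (Increasing and decreasing are understood in the non-strict sense.)
   Context: Parameters: $\lambda\ge 1$, $\gamma\in(0,1]$, $\Psi\ge0$, $R>0$, $\alpha\in(0,1)$, $k>1$, $\beta\le1$. The constant $c>1$ is the solution of $\frac{\alpha}{\beta}c(c-1)^{\alpha-1}-(c-1)^\alpha-k=0$. The quantities $p_1^*,p_2^*$ are the boundaries of the optimal purchase region of a speculative trader (price following a geometric Brownian motion with drift $\mu\ge0$, volatility $\sigma>0$, $\beta=1-2\mu/\sigma^2$; utility $x^\alpha$ for gains, $-k|x|^\alpha$ for losses; purchase at price $p$ costs $\lambda p+\Psi$, sale at price $p$ yields $\gamma p$; aspiration level $R$). They are defined as follows. Let $f(x):=\bigl[\frac{\alpha}{\beta}c^{1-\beta}(c-1)^{\alpha-1}x-k(\frac{\lambda}{\gamma}x^{1/\beta}+1)^\beta\bigr]\bigl(\frac{\lambda}{\gamma}x^{1/\beta}+1\bigr)^{\alpha-\beta}$ for $x\ge0$. Case (1): $\frac{\lambda}{\gamma}\le\bigl[\frac{\alpha}{\beta k}c^{1-\beta}(c-1)^{\alpha-1}\bigr]^{1/\beta}$. Then $p_1^*$ is well-defined (and $p_2^*$ is not); the purchase region is $[p_1^*,\infty)$. Case (2)(a):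 $\frac{\lambda}{\gamma}>\bigl[\frac{\alpha}{\beta k}c^{1-\beta}(c-1)^{\alpha-1}\bigr]^{1/\beta}$ (and additionally $\frac{\lambda}{\gamma}<\frac{(c-1)^{\alpha-1}}{k}$ if $\beta=1$), and $\Psi<CR$, where $C:=\bigl[-k/\max_{x\ge0}f(x)\bigr]^{1/\alpha}-1\in(0,\infty)$ (here $-k<\max f<0$). Then both $p_1^*<p_2^*$ are well-defined; the purchase region is $[p_1^*,p_2^*]$. In all other cases neither is defined. In cases (1) and (2)(a), $p_1^*=\frac{R+\Psi}{\gamma}(x_1^* )^{1/\beta}$, where $x_1^*$ is the smallest nonnegative solution of $$k=\Bigl(1+\frac{\Psi}{R}\Bigr)^\alpha\,\frac{k\bigl(\frac{\lambda}{\gamma}x^{1/\beta}+1\bigr)^\beta\bigl[\frac{\lambda}{\gamma}\bigl(1-\frac{\alpha}{\beta}\bigr)x^{1/\beta}+1\bigr]-\frac{\alpha}{\beta}c^{1-\beta}(c-1)^{\alpha-1}\frac{\lambda}{\gamma}\bigl(1-\frac{\alpha}{\beta}\bigr)x^{1/\beta+1}}{\bigl(\frac{\lambda}{\gamma}x^{1/\beta}+1\bigr)^{\beta-\alpha+1}}.$$ In case (2)(a), $p_2^*=\frac{R+\Psi}{\gamma}(x_2^* )^{1/\beta}$, where $x_2^*$ is the unique solution in $(0,\infty)$ of $$c^{1-\beta}(c-1)^{\alpha-1}\Bigl(x^{-1/\beta}+\frac{\lambda\alpha}{\gamma\beta}\Bigr)-\frac{k\lambda}{\gamma}\Bigl(x^{-1/\beta}+\frac{\lambda}{\gamma}\Bigr)^\beta=0.$$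 *)

theory Defs
  imports Complex_Main
begin

text \<open>
  Parameters throughout: \<open>\<alpha>\<close> (utility exponent), \<open>\<beta> = 1 - 2 \<mu> / \<sigma>\<^sup>2\<close>, \<open>k\<close> (loss aversion),
  \<open>l\<close> and \<open>\<gamma>\<close> (proportional costs at purchase and sale; \<open>l\<close> is the paper's lambda),
  \<open>\<Psi>\<close> (fixed purchase cost) and \<open>R\<close> (aspiration level).  All powers are real powers; since
  \<open>0 powr a = 0\<close>, the boundary value \<open>x = 0\<close> is treated as usual for positive exponents.
\<close>

definition c_const :: "real \<Rightarrow> real \<Rightarrow> real \<Rightarrow> real" where
  "c_const \<alpha> \<beta> k =
     (THE c. c > 1 \<and> \<alpha> / \<beta> * c * (c - 1) powr (\<alpha> - 1) - (c - 1) powr \<alpha> - k = 0)"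

definition c_fac :: "real \<Rightarrow> real \<Rightarrow> real \<Rightarrow> real" where
  "c_fac \<alpha> \<beta> k = c_const \<alpha> \<beta> k powr (1 - \<beta>) * (c_const \<alpha> \<beta> k - 1) powr (\<alpha> - 1)"

definition f_fun :: "real \<Rightarrow> real \<Rightarrow> real \<Rightarrow> real \<Rightarrow> real \<Rightarrow> real \<Rightarrow> real" where
  "f_fun \<alpha> \<beta> k l \<gamma> x =
     (\<alpha> / \<beta> * c_fac \<alpha> \<beta> k * x - k * (l / \<gamma> * x powr (1 / \<beta>) + 1) powr \<beta>)
       * (l / \<gamma> * x powr (1 / \<beta>) + 1) powr (\<alpha> - \<beta>)"

definition C_const :: "real \<Rightarrow> real \<Rightarrow> real \<Rightarrow> real \<Rightarrow> real \<Rightarrow> real" where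
  "C_const \<alpha> \<beta> k l \<gamma> =
     (- k / (GREATEST y. y \<in> f_fun \<alpha> \<beta> k l \<gamma> ` {0..})) powr (1 / \<alpha>) - 1"

definition case1 :: "real \<Rightarrow> real \<Rightarrow> real \<Rightarrow> real \<Rightarrow> real \<Rightarrow> bool" where
  "case1 \<alpha> \<beta> k l \<gamma> \<longleftrightarrow> l / \<gamma> \<le> (\<alpha> / (\<beta> * k) * c_fac \<alpha> \<beta> k) powr (1 / \<beta>)"

definition case2a ::
  "real \<Rightarrow> real \<Rightarrow> real \<Rightarrow> real \<Rightarrow> real \<Rightarrow> real \<Rightarrow> real \<Rightarrow> bool" where
  "case2a \<alpha> \<beta> k l \<gamma> \<Psi> R \<longleftrightarrow>
     l / \<gamma> > (\<alpha> / (\<beta> * k) * c_fac \<alpha> \<beta> k) powr (1 / \<beta>) \<and>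
     (\<beta> = 1 \<longrightarrow> l / \<gamma> < (c_const \<alpha> \<beta> k - 1) powr (\<alpha> - 1) / k) \<and>
     \<Psi> < C_const \<alpha> \<beta> k l \<gamma> * R"

definition p1_defined ::
  "real \<Rightarrow> real \<Rightarrow> real \<Rightarrow> real \<Rightarrow> real \<Rightarrow> real \<Rightarrow> real \<Rightarrow> bool" where
  "p1_defined \<alpha> \<beta> k l \<gamma> \<Psi> R \<longleftrightarrow> case1 \<alpha> \<beta> k l \<gamma> \<or> case2a \<alpha> \<beta> k l \<gamma> \<Psi> R"

definition p2_defined ::
  "real \<Rightarrow> real \<Rightarrow> real \<Rightarrow> real \<Rightarrow> real \<Rightarrow> real \<Rightarrow> real \<Rightarrow> bool" where
  "p2_defined \<alpha> \<beta> k l \<gamma> \<Psi> R \<longleftrightarrow> case2a \<alpha> \<beta> k l \<gamma> \<Psi> R"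

definition x1_star ::
  "real \<Rightarrow> real \<Rightarrow> real \<Rightarrow> real \<Rightarrow> real \<Rightarrow> real \<Rightarrow> real \<Rightarrow> real" where
  "x1_star \<alpha> \<beta> k l \<gamma> \<Psi> R =
     (LEAST x. x \<ge> 0 \<and>
        k = (1 + \<Psi> / R) powr \<alpha> *
            ((k * (l / \<gamma> * x powr (1 / \<beta>) + 1) powr \<beta>
                * (l / \<gamma> * (1 - \<alpha> / \<beta>) * x powr (1 / \<beta>) + 1)
              - \<alpha> / \<beta> * c_fac \<alpha> \<beta> k * (l / \<gamma>) * (1 - \<alpha> / \<beta>) * x powr (1 / \<beta> + 1))
             / (l / \<gamma> * x powr (1 / \<beta>) + 1) powr (\<beta> - \<alpha> + 1)))"

definition x2_star :: "real \<Rightarrow> real \<Rightarrow> real \<Rightarrow> real \<Rightarrow> real \<Rightarrow> real" where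
  "x2_star \<alpha> \<beta> k l \<gamma> =
     (THE x. x > 0 \<and>
        c_fac \<alpha> \<beta> k * (x powr (- 1 / \<beta>) + l * \<alpha> / (\<gamma> * \<beta>))
          - k * l / \<gamma> * (x powr (- 1 / \<beta>) + l / \<gamma>) powr \<beta> = 0)"

text \<open>
  The boundaries are total functions here; their values are meaningful only for parameters
  satisfying \<open>p1_defined\<close> and \<open>p2_defined\<close>, respectively.
\<close>

definition p1_star ::
  "real \<Rightarrow> real \<Rightarrow> real \<Rightarrow> real \<Rightarrow> real \<Rightarrow> real \<Rightarrow> real \<Rightarrow> real" where
  "p1_star \<alpha> \<beta> k l \<gamma> \<Psi> R = (R + \<Psi>) / \<gamma> * x1_star \<alpha> \<beta> k l \<gamma> \<Psi> R powr (1 / \<beta>)"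

definition p2_star ::
  "real \<Rightarrow> real \<Rightarrow> real \<Rightarrow> real \<Rightarrow> real \<Rightarrow> real \<Rightarrow> real \<Rightarrow> real" where
  "p2_star \<alpha> \<beta> k l \<gamma> \<Psi> R = (R + \<Psi>) / \<gamma> * x2_star \<alpha> \<beta> k l \<gamma> powr (1 / \<beta>)"

end

theory Submission
  imports Defs
begin

text \<open>
  Put \<open>u = (l / \<gamma>) x\<^bsup>1/\<beta>\<^esup>\<close>, so that a price \<open>p\<close> corresponds to \<open>u = l p / (R + \<Psi>)\<close>, which is
  independent of \<open>\<gamma>\<close>. In this variable the equation for \<open>p\<^sub>1\<close> reads
  \<open>(1 + \<Psi>/R)\<^bsup>\<alpha>\<^esup> H\<^sub>B(u) = k\<close>, where \<open>\<gamma>\<close> enters only through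
  \<open>B = (\<alpha>/\<beta>) c\<^bsup>1-\<beta>\<^esup> (c-1)\<^bsup>\<alpha>-1\<^esup> (\<gamma>/l)\<^bsup>\<beta>\<^esup>\<close>. The left-hand side is at least \<open>k\<close> at
  \<open>u = 0\<close>, so any price at which it is at most \<open>k\<close> bounds the least root from above; hence it
  suffices that at a fixed price it decreases in \<open>\<gamma>\<close> (clear, as \<open>B\<close> increases) and increases in
  \<open>\<Psi>\<close> (because \<open>u\<^bsup>-\<alpha>\<^esup> H\<^sub>B(u)\<close> decreases in \<open>t = u / (u + 1)\<close>). A root exists
  in case (1) because \<open>H\<^sub>B(u) \<le> 2 k (u + 1)\<^bsup>\<alpha>-1\<^esup>\<close>, and in case (2)(a) because \<open>H\<^sub>B\<close> agrees
  with \<open>-f\<close> at the maximiser of \<open>f\<close>.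

  For \<open>p\<^sub>2\<close>, with \<open>w = 1 / u\<close>, the equation becomes
  \<open>(w + \<alpha>/\<beta>) / (1 + w)\<^bsup>\<beta>\<^esup> = const \<cdot> (l/\<gamma>)\<^bsup>\<beta>\<^esup>\<close>, whose left-hand side is strictly increasing,
  and \<open>p\<^sub>2 = (R + \<Psi>) / (l w)\<close>.
\<close>

locale trader =
  fixes \<alpha> \<beta> k :: real
  assumes alpha: "0 < \<alpha>" "\<alpha> < 1" "\<alpha> \<le> \<beta>" and beta: "\<beta> \<le> 1" and k: "k > 1"
begin

section \<open>The constant c and the threshold between the cases\<close>

lemma beta_pos: "0 < \<beta>"
  using alpha by simp

lemma ratio: "0 < \<alpha> / \<beta>" "\<alpha> / \<beta> \<le> 1"
  using alpha by auto

text \<open>In terms of d = c - 1 the defining equation is \<open>\<phi> d = k\<close>. Near 0 the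
  function \<open>\<phi>\<close> exceeds k, while \<open>\<phi> 1\<close> = 2a - 1 < k, so a root
  exists. Where \<open>\<phi>\<close> is positive it is the product of a strictly decreasing and a
  nonincreasing factor, so the root is unique and \<open>THE\<close> denotes it.\<close>

lemma c_const_gt_1: "c_const \<alpha> \<beta> k > 1"
proof -
  define a where "a = \<alpha> / \<beta>"
  define \<phi> where "\<phi> d = d powr (\<alpha> - 1) * (a + (a - 1) * d)" for d
  have a: "0 < a" "a \<le> 1" using ratio by (auto simp: a_def)
  have eq: "\<alpha> / \<beta> * c * (c - 1) powr (\<alpha> - 1) - (c - 1) powr \<alpha> = \<phi> (c - 1)" if "c > 1" for c
  proof -
    have "(c - 1) powr \<alpha> = (c - 1) powr (\<alpha> - 1) * (c - 1)"
      using that powr_add[of "c - 1" "\<alpha> - 1" 1] by simp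
    then show ?thesis unfolding \<phi>_def a_def
      by (simp only: left_diff_distrib right_diff_distrib distrib_left) simp
  qed
  \<comment> \<open>The bound a/2 keeps the affine factor of \<open>\<phi>\<close> at least a/2; the
    other bound makes the power at least 2k/a.\<close>
  define d0 where "d0 = min (a / 2) ((2 * k / a) powr (1 / (\<alpha> - 1)))"
  have d0: "0 < d0" "d0 \<le> 1" using a k by (auto simp: d0_def)
  have "2 * k / a = ((2 * k / a) powr (1 / (\<alpha> - 1))) powr (\<alpha> - 1)"
    using a k alpha by (simp add: powr_powr)
  also have "\<dots> \<le> d0 powr (\<alpha> - 1)"
    by (rule powr_mono2') (use alpha d0 in \<open>auto simp: d0_def\<close>)
  finally have "2 * k / a * (a / 2) \<le> d0 powr (\<alpha> - 1) * (a / 2)"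
    using a by (intro mult_right_mono) auto
  also have "\<dots> \<le> \<phi> d0"
  proof -
    have "d0 \<le> a / 2" by (simp add: d0_def)
    moreover have "0 \<le> a * d0" using a d0 by simp
    ultimately have "a / 2 \<le> a + (a - 1) * d0" by (simp add: algebra_simps)
    then show ?thesis unfolding \<phi>_def by (intro mult_left_mono) auto
  qed
  finally have lo: "k \<le> \<phi> d0" using a by simp
  have hi: "\<phi> 1 \<le> k" using a k by (simp add: \<phi>_def)
  have "continuous_on {d0..1} \<phi>"
    unfolding \<phi>_def using d0 by (intro continuous_intros) auto
  then obtain d where d: "d0 \<le> d" "\<phi> d = k"
    using IVT2'[of \<phi> 1 k d0] lo hi d0 by auto
  have neq: "\<phi> x \<noteq> k \<or> \<phi> y \<noteq> k" if "0 < x" "x < y" for x y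
  proof (rule ccontr)
    assume "\<not> ?thesis"
    then have xy: "\<phi> x = k" "\<phi> y = k" by auto
    have "y powr (\<alpha> - 1) > 0" using that by simp
    then have pos: "a + (a - 1) * y > 0"
      using xy(2) k unfolding \<phi>_def by (smt (verit) zero_less_mult_iff)
    have le: "(a - 1) * y \<le> (a - 1) * x" using that a by (intro mult_left_mono_neg) auto
    have "y powr (\<alpha> - 1) < x powr (\<alpha> - 1)"
      using that alpha by (intro powr_less_mono2_neg) auto
    then have "\<phi> y < x powr (\<alpha> - 1) * (a + (a - 1) * y)"
      unfolding \<phi>_def using pos by (intro mult_strict_right_mono)
    also have "\<dots> \<le> \<phi> x" unfolding \<phi>_def using le by (intro mult_left_mono) auto
    finally show False using xy by simp
  qed
  define Q where "Q c \<longleftrightarrow> c > 1 \<and> \<alpha> / \<beta> * c * (c - 1) powr (\<alpha> - 1) - (c - 1) powr \<alpha> - k = 0" for c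
  have Q: "Q c \<longleftrightarrow> c > 1 \<and> \<phi> (c - 1) = k" for c
    unfolding Q_def using eq[of c] by auto
  have "\<exists>!c. Q c"
  proof (rule ex1I[of _ "1 + d"])
    show "Q (1 + d)" using d d0 by (simp add: Q)
  next
    fix c assume "Q c"
    then have c: "c - 1 > 0" "\<phi> (c - 1) = k" by (auto simp: Q)
    show "c = 1 + d"
      using neq[of "c - 1" d] neq[of d "c - 1"] c d d0 by (cases "c - 1" d rule: linorder_cases) auto
  qed
  then have "Q (THE c. Q c)" by (rule theI')
  then show ?thesis unfolding Q_def c_const_def by simp
qed

lemma c_fac_pos: "c_fac \<alpha> \<beta> k > 0"
  using c_const_gt_1 by (simp add: c_fac_def)

text \<open>This is B of the overview as a function of m = l/\<gamma>. In the variable u the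
  equation for p1 depends on l and \<gamma> only through it.\<close>

definition bratio :: "real \<Rightarrow> real" where
  "bratio m = \<alpha> / \<beta> * c_fac \<alpha> \<beta> k / m powr \<beta>"

lemma bratio_pos: "m > 0 \<Longrightarrow> bratio m > 0"
  using alpha beta_pos c_fac_pos by (simp add: bratio_def)

lemma bratio_antimono: "0 < m \<Longrightarrow> m \<le> m' \<Longrightarrow> bratio m' \<le> bratio m"
  unfolding bratio_def using alpha c_fac_pos beta_pos
  by (intro divide_left_mono powr_mono2 mult_nonneg_nonneg) auto

text \<open>Raising to the power \<beta> and clearing denominators turns case (1) into the
  comparison of B with k, the form in which the case distinction is used below.\<close>

lemma threshold_iff:
  assumes "m > 0"
  shows "m \<le> (\<alpha> / (\<beta> * k) * c_fac \<alpha> \<beta> k) powr (1 / \<beta>) \<longleftrightarrow> k \<le> bratio m"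
proof -
  define Z where "Z = \<alpha> / (\<beta> * k) * c_fac \<alpha> \<beta> k"
  have Z: "Z > 0" using alpha beta_pos k c_fac_pos by (simp add: Z_def)
  have "m \<le> Z powr (1 / \<beta>) \<longleftrightarrow> m powr \<beta> \<le> (Z powr (1 / \<beta>)) powr \<beta>"
    using powr_mono2[of \<beta> m "Z powr (1 / \<beta>)"] powr_less_mono2[of \<beta> "Z powr (1 / \<beta>)" m]
      assms beta_pos by force
  also have "\<dots> \<longleftrightarrow> m powr \<beta> \<le> Z" using beta_pos Z by (simp add: powr_powr)
  also have "\<dots> \<longleftrightarrow> k \<le> bratio m"
    using assms beta_pos k by (simp add: bratio_def Z_def field_simps)
  finally show ?thesis by (simp add: Z_def)
qed

section \<open>The equation for p1 in the variable u, and its least root\<close>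

text \<open>This is \<open>H\<^sub>B(u)\<close>; \<open>neg_f\<close> below is \<open>-f\<close> in the variable \<open>u\<close>.\<close>

definition lhs_shape :: "real \<Rightarrow> real \<Rightarrow> real" where
  "lhs_shape B u = k * ((1 - \<alpha> / \<beta>) * u + 1) * (u + 1) powr (\<alpha> - 1)
     - (1 - \<alpha> / \<beta>) * B * u powr (1 + \<beta>) * (u + 1) powr (\<alpha> - \<beta> - 1)"

text \<open>The term is literally the one inside \<open>x1_star\<close>, with m for l/\<gamma> and
  \<psi> for 1 + \<Psi>/R, so that it can be folded there.\<close>

definition x1_lhs :: "real \<Rightarrow> real \<Rightarrow> real \<Rightarrow> real" where
  "x1_lhs m \<psi> x = \<psi> powr \<alpha> *
            ((k * (m * x powr (1 / \<beta>) + 1) powr \<beta>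
                * (m * (1 - \<alpha> / \<beta>) * x powr (1 / \<beta>) + 1)
              - \<alpha> / \<beta> * c_fac \<alpha> \<beta> k * m * (1 - \<alpha> / \<beta>) * x powr (1 / \<beta> + 1))
             / (m * x powr (1 / \<beta>) + 1) powr (\<beta> - \<alpha> + 1))"

lemma x_of_u: "m > 0 \<Longrightarrow> u \<ge> 0 \<Longrightarrow> m * ((u / m) powr \<beta>) powr (1 / \<beta>) = u"
  using beta_pos by (simp add: powr_powr)

lemma x1_lhs_eq:
  assumes "m > 0" "x \<ge> 0"
  shows "x1_lhs m \<psi> x = \<psi> powr \<alpha> * lhs_shape (bratio m) (m * x powr (1 / \<beta>))"
proof -
  define u where "u = m * x powr (1 / \<beta>)"
  have u: "u \<ge> 0" using assms by (simp add: u_def)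
  have x: "x = u powr \<beta> / m powr \<beta>"
    using assms beta_pos by (simp add: u_def powr_mult powr_powr)
  have "x powr (1 / \<beta> + 1) = x powr (1 / \<beta>) * x"
    using assms by (simp add: powr_add)
  \<comment> \<open>One factor x is rewritten as a quotient of powers of u and m; the power of m is
    absorbed by \<open>bratio\<close>.\<close>
  then have 1: "\<alpha> / \<beta> * c_fac \<alpha> \<beta> k * m * (1 - \<alpha> / \<beta>) * x powr (1 / \<beta> + 1)
     = (1 - \<alpha> / \<beta>) * bratio m * (u * u powr \<beta>)"
    by (subst (asm) (2) x) (simp add: u_def bratio_def)
  have 2: "u * u powr \<beta> = u powr (1 + \<beta>)" using u by (simp add: powr_add)
  have 3: "(u + 1) powr \<beta> / (u + 1) powr (\<beta> - \<alpha> + 1) = (u + 1) powr (\<alpha> - 1)"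
    by (simp flip: powr_diff)
  have 4: "1 / (u + 1) powr (\<beta> - \<alpha> + 1) = (u + 1) powr (\<alpha> - \<beta> - 1)"
    using powr_minus_divide[of "u + 1" "\<beta> - \<alpha> + 1"] by simp
  have "x1_lhs m \<psi> x = \<psi> powr \<alpha> * (k * ((1 - \<alpha> / \<beta>) * u + 1) * ((u + 1) powr \<beta> / (u + 1) powr (\<beta> - \<alpha> + 1))
     - (1 - \<alpha> / \<beta>) * bratio m * (u * u powr \<beta>) * (1 / (u + 1) powr (\<beta> - \<alpha> + 1)))"
    unfolding x1_lhs_def 1 by (simp add: diff_divide_distrib mult_ac flip: u_def)
       (simp add: u_def mult_ac)?
  then show ?thesis unfolding 2 3 4 by (simp add: lhs_shape_def u_def)
qed

lemma continuous_x1_lhs: "m > 0 \<Longrightarrow> continuous_on {0..} (x1_lhs m \<psi>)"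
proof -
  assume m: "m > 0"
  then have base: "m * x powr (1 / \<beta>) + 1 \<noteq> 0" for x
    using mult_nonneg_nonneg[OF less_imp_le powr_ge_zero, of m x "1 / \<beta>"] by linarith
  have x: "continuous_on {0..} (\<lambda>x::real. x powr e)" if "e > 0" for e
    using that by (intro continuous_on_powr' continuous_on_id continuous_on_const) auto
  have "continuous_on {0..} (\<lambda>x. (m * x powr (1 / \<beta>) + 1) powr e)" for e
    using base beta_pos
    by (intro continuous_on_powr continuous_on_add continuous_on_mult continuous_on_const x) auto
  then show ?thesis
    unfolding x1_lhs_def using base beta_pos
    by (intro continuous_on_mult continuous_on_divide continuous_on_diff continuous_on_add
        continuous_on_const x) (auto intro: add_pos_pos)
qed

text \<open>A real \<open>LEAST\<close> needs an attained minimum. The roots in [0, b] form a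
  compact set, nonempty by the intermediate value theorem because the value at 0 is
  \<open>\<psi> powr \<alpha> * k\<close> \<ge> k for \<psi> = 1 + P/R. Roots beyond b cannot be the
  least.\<close>

lemma x1_star_root:
  assumes "l > 0" "g > 0" "R > 0" "P \<ge> 0" and b: "b \<ge> 0" "x1_lhs (l / g) (1 + P / R) b \<le> k"
  defines "x \<equiv> x1_star \<alpha> \<beta> k l g P R"
  shows "0 \<le> x" "x \<le> b" "x1_lhs (l / g) (1 + P / R) x = k"
proof -
  let ?F = "x1_lhs (l / g) (1 + P / R)"
  have m: "l / g > 0" using assms by simp
  define S where "S = {0..b} \<inter> ?F -` {k}"
  have cont: "continuous_on {0..b} ?F"
    by (rule continuous_on_subset[OF continuous_x1_lhs[OF m]]) auto
  have "(1 + P / R) powr \<alpha> \<ge> 1" using assms alpha by (intro ge_one_powr_ge_zero) auto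
  then have F0: "?F 0 \<ge> k" using k by (simp add: x1_lhs_def)
  have "S \<noteq> {}" using IVT2'[OF b(2) F0 b(1) cont] by (auto simp: S_def)
  moreover have "closed S"
    using cont continuous_on_closed_vimage[of "{0..b}" ?F] by (auto simp: S_def Int_commute)
  then have "compact S"
    using compact_Int_closed[OF compact_Icc, of S 0 b] by (simp add: S_def)
  ultimately obtain r where r: "r \<in> S" "\<And>y. y \<in> S \<Longrightarrow> r \<le> y"
    using compact_attains_inf by metis
  have "x = r"
    unfolding x_def x1_star_def x1_lhs_def[symmetric]
  proof (rule Least_equality)
    show "r \<ge> 0 \<and> k = ?F r" using r(1) by (auto simp: S_def)
    fix y assume "y \<ge> 0 \<and> k = ?F y"
    then show "r \<le> y" using r by (cases "y \<le> b") (auto simp: S_def)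
  qed
  then show "0 \<le> x" "x \<le> b" "?F x = k" using r(1) by (auto simp: S_def)
qed

section \<open>Existence of a root in cases (1) and (2)(a)\<close>

text \<open>With t = u/(u + 1) one has t \<le> \<open>t powr \<beta>\<close>, since \<beta> \<le> 1,
  hence u - u \<open>t powr \<beta>\<close> \<le> u - u t = t \<le> 1. So for B \<ge> k the
  subtracted term cancels the linear growth of the first one.\<close>

lemma lhs_shape_le:
  assumes "u \<ge> 0" "k \<le> B"
  shows "lhs_shape B u \<le> 2 * k * (u + 1) powr (\<alpha> - 1)"
proof -
  define t where "t = u / (u + 1)"
  have t: "0 \<le> t" "t \<le> 1" using assms by (auto simp: t_def)
  have "t \<le> t powr \<beta>" 
    using powr_mono'[of \<beta> 1 t] t beta by simp
  then have "u * t \<le> u * t powr \<beta>" using assms by (intro mult_left_mono)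
  moreover have "u - u * t \<le> 1" using assms by (simp add: t_def field_simps)
  ultimately have ut: "u - u * t powr \<beta> \<le> 1" by simp
  have "(1 - \<alpha> / \<beta>) * (u - u * t powr \<beta>) \<le> 1"
  proof -
    have "(1 - \<alpha> / \<beta>) * (u - u * t powr \<beta>) \<le> (1 - \<alpha> / \<beta>) * 1"
      using ut ratio by (intro mult_left_mono) auto
    also have "\<dots> \<le> 1" using ratio by simp
    finally show ?thesis .
  qed
  then have *: "k * ((1 - \<alpha> / \<beta>) * (u - u * t powr \<beta>) + 1) \<le> k * 2"
    using k by (intro mult_left_mono) auto
  have "k * ((1 - \<alpha> / \<beta>) * (u * t powr \<beta>)) \<le> B * ((1 - \<alpha> / \<beta>) * (u * t powr \<beta>))"
    using assms ratio by (intro mult_right_mono mult_nonneg_nonneg) auto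
  then have **: "k * ((1 - \<alpha> / \<beta>) * u + 1) - B * ((1 - \<alpha> / \<beta>) * (u * t powr \<beta>)) \<le> 2 * k"
    using * by (simp add: algebra_simps)
  have "u powr (1 + \<beta>) * (u + 1) powr (\<alpha> - \<beta> - 1) = (u * t powr \<beta>) * (u + 1) powr (\<alpha> - 1)"
  proof -
    have "(u + 1) powr (\<alpha> - \<beta> - 1) = (u + 1) powr (\<alpha> - 1) / (u + 1) powr \<beta>"
      by (simp add: algebra_simps flip: powr_diff)
    then show ?thesis using assms by (simp add: t_def powr_divide powr_add)
  qed
  then have "lhs_shape B u
    = (k * ((1 - \<alpha> / \<beta>) * u + 1) - B * ((1 - \<alpha> / \<beta>) * (u * t powr \<beta>))) * (u + 1) powr (\<alpha> - 1)"
    unfolding lhs_shape_def left_diff_distrib[of _ _ "(u + 1) powr (\<alpha> - 1)"]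
    by (simp only: mult.assoc mult.left_commute)
  also have "\<dots> \<le> 2 * k * (u + 1) powr (\<alpha> - 1)"
    using ** by (rule mult_right_mono) simp
  finally show ?thesis .
qed

definition neg_f :: "real \<Rightarrow> real \<Rightarrow> real" where
  "neg_f B u = k * (u + 1) powr \<alpha> - B * u powr \<beta> * (u + 1) powr (\<alpha> - \<beta>)"

lemma f_fun_eq:
  assumes "l > 0" "g > 0" "x \<ge> 0"
  shows "f_fun \<alpha> \<beta> k l g x = - neg_f (bratio (l / g)) (l / g * x powr (1 / \<beta>))"
proof -
  define m u where "m = l / g" and "u = m * x powr (1 / \<beta>)"
  have m: "m > 0" using assms by (simp add: m_def)
  have u: "u \<ge> 0" using m by (simp add: u_def)
  have x: "x = u powr \<beta> / m powr \<beta>"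
    using assms m beta_pos by (simp add: u_def powr_mult powr_powr)
  have 1: "\<alpha> / \<beta> * c_fac \<alpha> \<beta> k * x = bratio m * u powr \<beta>"
    by (subst x) (simp add: bratio_def)
  have 2: "(u + 1) powr \<beta> * (u + 1) powr (\<alpha> - \<beta>) = (u + 1) powr \<alpha>"
    by (simp flip: powr_add)
  have "f_fun \<alpha> \<beta> k l g x = (bratio m * u powr \<beta> - k * (u + 1) powr \<beta>) * (u + 1) powr (\<alpha> - \<beta>)"
    unfolding f_fun_def 1 by (simp add: u_def m_def)
  also have "\<dots> = - neg_f (bratio m) u"
    by (simp add: neg_f_def left_diff_distrib mult.assoc 2)
  finally show ?thesis by (simp add: u_def m_def)
qed

text \<open>The reason is \<open>u powr \<beta>\<close> \<le> \<open>(u + 1) powr \<beta>\<close>.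
  For B < k the bound makes \<open>neg_f B\<close> positive and coercive, so f has a negative
  maximum that is attained.\<close>

lemma neg_f_lower:
  assumes "u \<ge> 0" "B \<ge> 0"
  shows "(k - B) * (u + 1) powr \<alpha> \<le> neg_f B u"
proof -
  have "u powr \<beta> * (u + 1) powr (\<alpha> - \<beta>) \<le> (u + 1) powr \<beta> * (u + 1) powr (\<alpha> - \<beta>)"
    using assms beta_pos by (intro mult_right_mono powr_mono2) auto
  also have "\<dots> = (u + 1) powr \<alpha>" by (simp flip: powr_add)
  finally have "B * (u powr \<beta> * (u + 1) powr (\<alpha> - \<beta>)) \<le> B * (u + 1) powr \<alpha>"
    using assms by (intro mult_left_mono)
  then show ?thesis by (simp add: neg_f_def algebra_simps)
qed

lemma neg_f_min:
  assumes "B \<ge> 0" "B < k"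
  obtains u where "u \<ge> 0" "\<And>v. v \<ge> 0 \<Longrightarrow> neg_f B u \<le> neg_f B v"
proof -
  \<comment> \<open>M solves \<open>(k - B) * M powr \<alpha>\<close> = k =
    \<open>neg_f B 0\<close>, so beyond M the lower bound is no smaller than the value at 0.\<close>
  define M where "M = (k / (k - B)) powr (1 / \<alpha>)"
  have M: "M \<ge> 0" by (simp add: M_def)
  have "continuous_on {0..M} (neg_f B)"
    unfolding neg_f_def using beta_pos alpha
    by (intro continuous_intros continuous_on_powr') auto
  then obtain u where u: "u \<in> {0..M}" "\<And>v. v \<in> {0..M} \<Longrightarrow> neg_f B u \<le> neg_f B v"
    using continuous_attains_inf[of "{0..M}" "neg_f B"] M by auto
  show thesis
  proof
    show "u \<ge> 0" using u by simp
    fix v :: real assume v: "v \<ge> 0"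
    show "neg_f B u \<le> neg_f B v"
    proof (cases "v \<le> M")
      case True then show ?thesis using u v by simp
    next
      case False
      have "neg_f B u \<le> neg_f B 0" using u M by simp
      also have "\<dots> = (k - B) * M powr \<alpha>"
        using alpha assms k by (simp add: M_def powr_powr neg_f_def)
      also have "\<dots> \<le> (k - B) * (v + 1) powr \<alpha>"
        using False assms alpha M by (intro mult_left_mono powr_mono2) auto
      also have "\<dots> \<le> neg_f B v" using v assms by (intro neg_f_lower)
      finally show ?thesis .
    qed
  qed
qed

text \<open>For u > 0, \<open>neg_f B u - lhs_shape B u\<close> is u/\<beta> times the derivative of
  \<open>neg_f B\<close> at u, which vanishes at an interior minimiser. At u = 0 both functions
  equal k.\<close>

lemma lhs_shape_at_min:
  assumes u: "u \<ge> 0" and min: "\<And>v. v \<ge> 0 \<Longrightarrow> neg_f B u \<le> neg_f B v"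
  shows "lhs_shape B u = neg_f B u"
proof (cases "u = 0")
  case True then show ?thesis by (simp add: lhs_shape_def neg_f_def)
next
  case False
  then have u: "u > 0" using u by simp
  let ?D = "k * (\<alpha> * (u + 1) powr (\<alpha> - 1)) - B * (\<beta> * u powr (\<beta> - 1) * (u + 1) powr (\<alpha> - \<beta>)
     + u powr \<beta> * ((\<alpha> - \<beta>) * (u + 1) powr (\<alpha> - \<beta> - 1)))"
  have "(neg_f B has_real_derivative ?D) (at u)"
    unfolding neg_f_def using u
    by (auto intro!: derivative_eq_intros simp: algebra_simps)
  then have D: "?D = 0"
    by (rule DERIV_local_min[of _ _ _ u]) (use u min in auto)
  have U: "u powr (\<beta> - 1) = u powr \<beta> / u" using u by (simp add: powr_diff)
  define X where "X = (u + 1) powr (\<alpha> - \<beta> - 1)"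
  have X: "(u + 1) powr (\<alpha> - \<beta>) = X * (u + 1)"
    using u powr_add[of "u + 1" "\<alpha> - \<beta> - 1" 1] by (simp add: X_def)
  define Y where "Y = (u + 1) powr (\<alpha> - 1)"
  have Y: "(u + 1) powr \<alpha> = Y * (u + 1)"
    using u powr_add[of "u + 1" "\<alpha> - 1" 1] by (simp add: Y_def)
  have "k * \<alpha> * Y * u = B * u powr \<beta> * X * (\<beta> + \<alpha> * u)"
    using D[unfolded U X, folded X_def Y_def] u by (simp add: field_simps)
  then have "k * Y * (\<alpha> / \<beta> * u) = B * u powr \<beta> * X * (1 + \<alpha> / \<beta> * u)"
    using beta_pos by (simp add: field_simps)
  then show ?thesis
    unfolding lhs_shape_def neg_f_def X Y X_def[symmetric] Y_def[symmetric] powr_add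
    using u by (simp add: algebra_simps)
qed

lemma C_const_eq:
  assumes "l > 0" "g > 0" and u: "u \<ge> 0"
    and min: "\<And>v. v \<ge> 0 \<Longrightarrow> neg_f (bratio (l / g)) u \<le> neg_f (bratio (l / g)) v"
  shows "C_const \<alpha> \<beta> k l g = (k / neg_f (bratio (l / g)) u) powr (1 / \<alpha>) - 1"
proof -
  have m: "l / g > 0" using assms by simp
  have "(GREATEST y. y \<in> f_fun \<alpha> \<beta> k l g ` {0..}) = - neg_f (bratio (l / g)) u"
  proof (rule Greatest_equality)
    let ?x = "(u / (l / g)) powr \<beta>"
    have "f_fun \<alpha> \<beta> k l g ?x = - neg_f (bratio (l / g)) u"
      using f_fun_eq[of l g ?x] x_of_u[OF m u] assms by simp
    then show "- neg_f (bratio (l / g)) u \<in> f_fun \<alpha> \<beta> k l g ` {0..}"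
      by (intro image_eqI[of _ _ ?x]) auto
  next
    fix y assume "y \<in> f_fun \<alpha> \<beta> k l g ` {0..}"
    then obtain x where "x \<ge> 0" "y = f_fun \<alpha> \<beta> k l g x" by auto
    then show "y \<le> - neg_f (bratio (l / g)) u"
      using f_fun_eq[of l g x] assms min[of "l / g * x powr (1 / \<beta>)"] by simp
  qed
  then show ?thesis by (simp add: C_const_def)
qed

lemma x1_lhs_small:
  assumes pos: "l > 0" "g > 0" "R > 0" "P \<ge> 0" and def: "p1_defined \<alpha> \<beta> k l g P R"
  obtains b where "b \<ge> 0" "x1_lhs (l / g) (1 + P / R) b \<le> k"
proof -
  define B \<psi> where "B = bratio (l / g)" and "\<psi> = 1 + P / R"
  have m: "l / g > 0" using pos by simp
  have \<psi>: "\<psi> \<ge> 1" using pos by (simp add: \<psi>_def)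
  have B: "B > 0" using bratio_pos[OF m] by (simp add: B_def)
  have "\<exists>u\<ge>0. \<psi> powr \<alpha> * lhs_shape B u \<le> k"
  proof (cases "k \<le> B")
    case True
    \<comment> \<open>Chosen so that \<open>(u + 1) powr (\<alpha> - 1)\<close> is 1/(2
      \<open>\<psi> powr \<alpha>\<close>), which reduces the bound of \<open>lhs_shape_le\<close>
      to k.\<close>
    define u where "u = (2 * \<psi> powr \<alpha>) powr (1 / (1 - \<alpha>)) - 1"
    have \<psi>1: "\<psi> powr \<alpha> \<ge> 1" using \<psi> alpha by (intro ge_one_powr_ge_zero) auto
    have u: "u \<ge> 0" unfolding u_def using \<psi>1 alpha by (simp add: ge_one_powr_ge_zero)
    have "1 / (1 - \<alpha>) * (\<alpha> - 1) = -1" using alpha by (simp add: field_simps)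
    then have "(u + 1) powr (\<alpha> - 1) = 1 / (2 * \<psi> powr \<alpha>)"
      using \<psi>1 by (simp add: u_def powr_powr powr_minus_divide)
    then have "\<psi> powr \<alpha> * lhs_shape B u \<le> \<psi> powr \<alpha> * (2 * k * (1 / (2 * \<psi> powr \<alpha>)))"
      using lhs_shape_le[OF u True] by (intro mult_left_mono) auto
    also have "\<dots> = k" using \<psi> by simp
    finally show ?thesis using u by auto
  next
    case False
    then have "\<not> case1 \<alpha> \<beta> k l g" unfolding case1_def threshold_iff[OF m] by (simp add: B_def)
    \<comment> \<open>Solved for \<psi>, this bound says that \<open>\<psi> powr \<alpha>\<close>
      times the minimum of \<open>neg_f B\<close> is at most k; at the minimiser that minimum is
      also the value of \<open>lhs_shape B\<close>.\<close>
    then have C: "P < C_const \<alpha> \<beta> k l g * R" using def by (auto simp: p1_defined_def case2a_def)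
    obtain u where u: "u \<ge> 0" "\<And>v. v \<ge> 0 \<Longrightarrow> neg_f B u \<le> neg_f B v"
      using neg_f_min[of B] B False by auto
    have "0 < (k - B) * (u + 1) powr \<alpha>" using False u by simp
    then have n: "neg_f B u > 0" using neg_f_lower[OF u(1), of B] B by simp
    have "C_const \<alpha> \<beta> k l g = (k / neg_f B u) powr (1 / \<alpha>) - 1"
      unfolding B_def by (rule C_const_eq) (use pos u in \<open>auto simp: B_def\<close>)
    then have "P / R < (k / neg_f B u) powr (1 / \<alpha>) - 1"
      using C pos by (simp add: pos_divide_less_eq)
    then have "\<psi> < (k / neg_f B u) powr (1 / \<alpha>)" by (simp add: \<psi>_def)
    then have "\<psi> powr \<alpha> \<le> ((k / neg_f B u) powr (1 / \<alpha>)) powr \<alpha>"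
      using \<psi> alpha by (intro powr_mono2) auto
    also have "\<dots> = k / neg_f B u" using alpha k n by (simp add: powr_powr)
    finally have "\<psi> powr \<alpha> * neg_f B u \<le> k" using n by (simp add: field_simps)
    then show ?thesis using u(1) lhs_shape_at_min[OF u] by auto
  qed
  then obtain u where u: "u \<ge> 0" "\<psi> powr \<alpha> * lhs_shape B u \<le> k" by auto
  show thesis
  proof
    show "(u / (l / g)) powr \<beta> \<ge> 0" by simp
    show "x1_lhs (l / g) (1 + P / R) ((u / (l / g)) powr \<beta>) \<le> k"
      using u x1_lhs_eq[OF m, of "(u / (l / g)) powr \<beta>" \<psi>] x_of_u[OF m u(1)]
      by (simp add: \<psi>_def B_def)
  qed
qed

section \<open>Monotonicity of p1 in \<gamma> and \<Psi>\<close>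

text \<open>The facts about \<open>x1_star\<close> are restated for prices, so that different
  parameters can be compared at one price. The monotonicity proofs use only these three facts about
  \<open>p1_star\<close>.\<close>

lemma p1_star_root:
  assumes pos: "l > 0" "g > 0" "R > 0" "P \<ge> 0" and def: "p1_defined \<alpha> \<beta> k l g P R"
  shows "0 \<le> p1_star \<alpha> \<beta> k l g P R"
    "(1 + P / R) powr \<alpha> * lhs_shape (bratio (l / g)) (l * p1_star \<alpha> \<beta> k l g P R / (R + P)) = k"
    "\<And>p. p \<ge> 0 \<Longrightarrow> (1 + P / R) powr \<alpha> * lhs_shape (bratio (l / g)) (l * p / (R + P)) \<le> k
      \<Longrightarrow> p1_star \<alpha> \<beta> k l g P R \<le> p"
proof -
  define x where "x = x1_star \<alpha> \<beta> k l g P R"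
  have m: "l / g > 0" and RP: "R + P > 0" using pos by auto
  obtain b where b: "b \<ge> 0" "x1_lhs (l / g) (1 + P / R) b \<le> k"
    using x1_lhs_small[OF pos def] .
  have x: "0 \<le> x" "x1_lhs (l / g) (1 + P / R) x = k"
    using x1_star_root[OF pos b] by (auto simp: x_def)
  have p: "p1_star \<alpha> \<beta> k l g P R = (R + P) / g * x powr (1 / \<beta>)"
    by (simp add: p1_star_def x_def)
  show "0 \<le> p1_star \<alpha> \<beta> k l g P R" using p RP pos by simp
  have "l * p1_star \<alpha> \<beta> k l g P R / (R + P) = l / g * x powr (1 / \<beta>)"
    using p RP by simp
  then show "(1 + P / R) powr \<alpha> * lhs_shape (bratio (l / g)) (l * p1_star \<alpha> \<beta> k l g P R / (R + P)) = k"
    using x x1_lhs_eq[OF m] by simp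
  fix q :: real
  assume q: "q \<ge> 0" "(1 + P / R) powr \<alpha> * lhs_shape (bratio (l / g)) (l * q / (R + P)) \<le> k"
  \<comment> \<open>The x-value that belongs to the price q.\<close>
  define y where "y = (g * q / (R + P)) powr \<beta>"
  have y: "y powr (1 / \<beta>) = g * q / (R + P)"
    using q pos beta_pos by (simp add: y_def powr_powr)
  have "x1_lhs (l / g) (1 + P / R) y \<le> k"
    using q x1_lhs_eq[OF m, of y] y pos by (simp add: y_def)
  then have "x \<le> y"
    using x1_star_root(2)[OF pos, of y] by (simp add: x_def y_def)
  then have "x powr (1 / \<beta>) \<le> y powr (1 / \<beta>)" using x beta_pos by (intro powr_mono2) auto
  then have "(R + P) / g * x powr (1 / \<beta>) \<le> (R + P) / g * y powr (1 / \<beta>)"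
    using RP pos by (intro mult_left_mono) auto
  then show "p1_star \<alpha> \<beta> k l g P R \<le> q" using p y RP pos by simp
qed

lemma lhs_shape_antimono:
  assumes "B \<le> B'"
  shows "lhs_shape B' u \<le> lhs_shape B u"
proof -
  have "B * ((1 - \<alpha> / \<beta>) * u powr (1 + \<beta>) * (u + 1) powr (\<alpha> - \<beta> - 1))
     \<le> B' * ((1 - \<alpha> / \<beta>) * u powr (1 + \<beta>) * (u + 1) powr (\<alpha> - \<beta> - 1))"
    using assms ratio by (intro mult_right_mono) auto
  then show ?thesis by (simp add: lhs_shape_def mult_ac)
qed

lemma p1_star_antimono_gamma:
  assumes "l > 0" "R > 0" "P \<ge> 0" "0 < g" "g \<le> g'"
    and "p1_defined \<alpha> \<beta> k l g P R" "p1_defined \<alpha> \<beta> k l g' P R"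
  shows "p1_star \<alpha> \<beta> k l g' P R \<le> p1_star \<alpha> \<beta> k l g P R"
proof (rule p1_star_root(3))
  note r = p1_star_root(1,2)[OF \<open>l > 0\<close> \<open>0 < g\<close> \<open>R > 0\<close> \<open>P \<ge> 0\<close> assms(6)]
  show "p1_star \<alpha> \<beta> k l g P R \<ge> 0" by (rule r)
  have "bratio (l / g) \<le> bratio (l / g')"
    using assms by (intro bratio_antimono divide_left_mono) auto
  then have "(1 + P / R) powr \<alpha> * lhs_shape (bratio (l / g')) (l * p1_star \<alpha> \<beta> k l g P R / (R + P))
      \<le> (1 + P / R) powr \<alpha> * lhs_shape (bratio (l / g)) (l * p1_star \<alpha> \<beta> k l g P R / (R + P))"
    by (intro mult_left_mono lhs_shape_antimono) auto
  then show "(1 + P / R) powr \<alpha> * lhs_shape (bratio (l / g')) (l * p1_star \<alpha> \<beta> k l g P R / (R + P)) \<le> k"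
    using r by simp
qed (use assms in auto)

text \<open>Splitting off the power of u leaves a function of t alone. This rests on
  \<open>u powr \<alpha> * t powr (- \<alpha>)\<close> = \<open>(u + 1) powr \<alpha>\<close> and on
  t (u + 1) = u.\<close>

lemma lhs_shape_scaled:
  assumes "u > 0"
  defines "t \<equiv> u / (u + 1)"
  shows "lhs_shape B u = u powr \<alpha> * (k * (1 - \<alpha> / \<beta> * t) * t powr (- \<alpha>)
     - (1 - \<alpha> / \<beta>) * B * t powr (1 + \<beta> - \<alpha>))"
proof -
  have "u powr \<alpha> * t powr (- \<alpha>) = (u + 1) powr \<alpha>"
    using assms by (simp add: t_def powr_divide powr_minus field_simps)
  moreover have "(1 - \<alpha> / \<beta> * t) * (u + 1) = (1 - \<alpha> / \<beta>) * u + 1"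
  proof -
    have "t * (u + 1) = u" using assms(1) by (simp add: t_def)
    then show ?thesis by (metis (no_types, lifting) add.commute add_diff_eq
        left_diff_distrib mult.assoc mult_1)
  qed
  moreover have "(u + 1) powr \<alpha> = (u + 1) * (u + 1) powr (\<alpha> - 1)"
    using assms powr_add[of "u + 1" 1 "\<alpha> - 1"] by simp
  ultimately have 1: "u powr \<alpha> * (k * (1 - \<alpha> / \<beta> * t) * t powr (- \<alpha>))
    = k * ((1 - \<alpha> / \<beta>) * u + 1) * (u + 1) powr (\<alpha> - 1)"
    by (metis (no_types, lifting) mult.assoc mult.commute)
  have "u powr \<alpha> * t powr (1 + \<beta> - \<alpha>) = u powr \<alpha> * u powr (1 + \<beta> - \<alpha>) / (u + 1) powr (1 + \<beta> - \<alpha>)"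
    using assms by (simp add: t_def powr_divide)
  also have "\<dots> = u powr (1 + \<beta>) * (u + 1) powr (\<alpha> - \<beta> - 1)"
    using powr_minus_divide[of "u + 1" "1 + \<beta> - \<alpha>"] by (simp add: algebra_simps flip: powr_add)
  finally have 2: "u powr \<alpha> * t powr (1 + \<beta> - \<alpha>) = u powr (1 + \<beta>) * (u + 1) powr (\<alpha> - \<beta> - 1)" .
  show ?thesis
    unfolding lhs_shape_def right_diff_distrib[of "u powr \<alpha>"] 1
    by (simp only: mult.assoc mult.left_commute[of "u powr \<alpha>"] 2)
qed

text \<open>As a function of t, the first term is a product of nonnegative nonincreasing factors,
  because \<alpha>/\<beta> \<le> 1 and t \<le> 1. The subtracted term is nondecreasing since its
  exponent 1 + \<beta> - \<alpha> is positive.\<close>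

lemma lhs_shape_scaled_antimono:
  assumes "0 < u" "u \<le> v" "B \<ge> 0"
  shows "lhs_shape B v / v powr \<alpha> \<le> lhs_shape B u / u powr \<alpha>"
proof -
  define s t where "s = u / (u + 1)" and "t = v / (v + 1)"
  have st: "0 < s" "s \<le> t" "t \<le> 1" using assms by (auto simp: s_def t_def field_simps)
  have "\<alpha> / \<beta> * s \<le> \<alpha> / \<beta> * t" using st ratio by (intro mult_left_mono) auto
  moreover have "\<alpha> / \<beta> * t \<le> 1 * 1" using st ratio by (intro mult_mono) auto
  moreover have "t powr (- \<alpha>) \<le> s powr (- \<alpha>)" using st alpha by (intro powr_mono2') auto
  ultimately have "k * (1 - \<alpha> / \<beta> * t) * t powr (- \<alpha>) \<le> k * (1 - \<alpha> / \<beta> * s) * s powr (- \<alpha>)"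
    using k by (intro mult_mono mult_left_mono) auto
  moreover have "s powr (1 + \<beta> - \<alpha>) \<le> t powr (1 + \<beta> - \<alpha>)"
    using st alpha by (intro powr_mono2) auto
  then have "(1 - \<alpha> / \<beta>) * B * s powr (1 + \<beta> - \<alpha>) \<le> (1 - \<alpha> / \<beta>) * B * t powr (1 + \<beta> - \<alpha>)"
    using assms ratio by (intro mult_left_mono) auto
  ultimately show ?thesis
    using lhs_shape_scaled[of u B] lhs_shape_scaled[of v B] assms by (simp flip: s_def t_def)
qed

lemma p1_star_mono_Psi:
  assumes pos: "l > 0" "g > 0" "R > 0" "P \<ge> 0" "P \<le> P'"
    and def: "p1_defined \<alpha> \<beta> k l g P R" "p1_defined \<alpha> \<beta> k l g P' R"
  shows "p1_star \<alpha> \<beta> k l g P R \<le> p1_star \<alpha> \<beta> k l g P' R"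
proof (rule p1_star_root(3))
  define p B where "p = p1_star \<alpha> \<beta> k l g P' R" and "B = bratio (l / g)"
  have "P' \<ge> 0" using pos by simp
  note r = p1_star_root(1,2)[OF \<open>l > 0\<close> \<open>g > 0\<close> \<open>R > 0\<close> \<open>P' \<ge> 0\<close> def(2), folded p_def B_def]
  show "p1_star \<alpha> \<beta> k l g P' R \<ge> 0" using r by (simp add: p_def)
  have B: "B \<ge> 0" using bratio_pos[of "l / g"] pos by (simp add: B_def)
  have "(1 + P / R) powr \<alpha> * lhs_shape B (l * p / (R + P))
      \<le> (1 + P' / R) powr \<alpha> * lhs_shape B (l * p / (R + P'))"
  \<comment> \<open>Division by a power of u is impossible at p = 0; there \<open>lhs_shape\<close>
    equals k and only the prefactor varies.\<close>
  proof (cases "p = 0")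
    case True
    have "(1 + P / R) powr \<alpha> \<le> (1 + P' / R) powr \<alpha>"
      using pos alpha by (intro powr_mono2) (auto simp: divide_right_mono)
    then show ?thesis using True k by (simp add: lhs_shape_def)
  next
    case False
    then have p: "p > 0" using r by simp
    define u where "u Q = l * p / (R + Q)" for Q
    have u: "0 < u P'" "u P' \<le> u P"
      using p pos by (auto simp: u_def intro!: divide_left_mono)
    \<comment> \<open>Since l p/R = (1 + Q/R) u(Q), the dependence on Q is confined to the scaled
      shape, with a constant in front.\<close>
    have e: "(1 + Q / R) powr \<alpha> * lhs_shape B (u Q)
        = (l * p / R) powr \<alpha> * (lhs_shape B (u Q) / u Q powr \<alpha>)" if "Q \<ge> 0" for Q
    proof -
      have "u Q > 0" using that p pos by (simp add: u_def)
      moreover have "l * p / R = (1 + Q / R) * u Q"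
      proof -
        have "1 + Q / R = (R + Q) / R" using pos by (simp add: add_divide_distrib)
        then show ?thesis using that pos by (simp add: u_def)
      qed
      ultimately show ?thesis using that pos by (simp add: powr_mult)
    qed
    show ?thesis
      unfolding u_def[symmetric] e[OF \<open>P \<ge> 0\<close>] e[OF \<open>P' \<ge> 0\<close>]
      using lhs_shape_scaled_antimono[OF u B] by (rule mult_left_mono) simp
  qed
  then show "(1 + P / R) powr \<alpha> * lhs_shape (bratio (l / g)) (l * p1_star \<alpha> \<beta> k l g P' R / (R + P)) \<le> k"
    using r by (simp add: p_def B_def)
qed (use assms in auto)

section \<open>The equation for p2 in the variable w, and monotonicity of p2\<close>

definition w_shape :: "real \<Rightarrow> real" where
  "w_shape w = (w + \<alpha> / \<beta>) / (1 + w) powr \<beta>"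

text \<open>Up to a positive factor the derivative is (1 - \<alpha>) + (1 - \<beta>) x.\<close>

lemma w_shape_strict_mono:
  assumes "0 \<le> v" "v < w"
  shows "w_shape v < w_shape w"
proof (rule DERIV_pos_imp_increasing[OF assms(2)])
  fix x assume x: "v \<le> x" "x \<le> w"
  let ?a = "\<alpha> / \<beta>"
  have x0: "0 < 1 + x" using x assms by simp
  have "(w_shape has_real_derivative
     (1 * (1 + x) powr \<beta> - (x + ?a) * (\<beta> * (1 + x) powr (\<beta> - 1))) / ((1 + x) powr \<beta>)\<^sup>2) (at x)"
    unfolding w_shape_def using x0
    by (auto intro!: derivative_eq_intros simp: power2_eq_square)
  moreover have "(1 + x) powr \<beta> = (1 + x) * (1 + x) powr (\<beta> - 1)"
    using x0 powr_add[of "1 + x" 1 "\<beta> - 1"] by simp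
  moreover have "0 < (1 + x - \<beta> * x - \<alpha>) * (1 + x) powr (\<beta> - 1)"
  proof -
    have "\<beta> * x \<le> 1 * x" using beta x assms by (intro mult_right_mono) auto
    then show ?thesis using alpha x0 by simp
  qed
  then have "0 < (1 + x) * (1 + x) powr (\<beta> - 1) - (x + ?a) * (\<beta> * (1 + x) powr (\<beta> - 1))"
    using beta_pos by (simp add: algebra_simps)
  ultimately show "\<exists>y. DERIV w_shape x :> y \<and> 0 < y"
    using x0 by (metis divide_pos_pos mult_1 powr_gt_zero less_irrefl zero_less_power)
qed

text \<open>For \<beta> < 1 the function grows like \<open>w powr (1 - \<beta>)\<close>. For \<beta>
  = 1 it only tends to 1, which is why K < 1 is required then.\<close>

lemma w_shape_unbounded:
  assumes "0 < K" and "\<beta> = 1 \<longrightarrow> K < 1"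
  obtains w where "0 \<le> w" "K \<le> w_shape w"
proof (cases "\<beta> = 1")
  case True
  \<comment> \<open>Solves w/(1 + w) = K; the term \<alpha> in the numerator only helps.\<close>
  define w where "w = K / (1 - K)"
  have K: "K < 1" using True assms by simp
  have w: "w \<ge> 0" using assms K by (simp add: w_def)
  have "K = w / (1 + w)" using K by (simp add: w_def field_simps)
  also have "\<dots> \<le> w_shape w"
    unfolding w_shape_def using True w alpha by (simp add: divide_right_mono)
  finally show ?thesis using w that by blast
next
  case False
  then have b: "\<beta> < 1" using beta by simp
  \<comment> \<open>Gives w = 2 (K + 1) \<open>w powr \<beta>\<close>, which dominates K
    \<open>(1 + w) powr \<beta>\<close> because 1 + w \<le> 2 w.\<close>
  define w where "w = (2 * (K + 1)) powr (1 / (1 - \<beta>))"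
  have w: "w \<ge> 1" unfolding w_def using assms b by (intro ge_one_powr_ge_zero) auto
  have "2 powr \<beta> \<le> 2 powr 1" using b by (intro powr_mono) auto
  then have "(1 + w) powr \<beta> \<le> 2 * w powr \<beta>"
  proof -
    have "(1 + w) powr \<beta> \<le> (2 * w) powr \<beta>" using w beta_pos by (intro powr_mono2) auto
    also have "\<dots> = 2 powr \<beta> * w powr \<beta>" using w by (simp add: powr_mult)
    also have "\<dots> \<le> 2 * w powr \<beta>" using \<open>2 powr \<beta> \<le> 2 powr 1\<close> by (intro mult_right_mono) auto
    finally show ?thesis .
  qed
  have "w powr (1 - \<beta>) = 2 * (K + 1)" using assms b by (simp add: w_def powr_powr)
  then have "w = 2 * (K + 1) * w powr \<beta>"
    using w powr_add[of w "1 - \<beta>" \<beta>] by simp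
  moreover have "K * (1 + w) powr \<beta> \<le> K * (2 * w powr \<beta>)"
    using \<open>(1 + w) powr \<beta> \<le> 2 * w powr \<beta>\<close> assms by (intro mult_left_mono) auto
  moreover have "2 * (K + 1) * w powr \<beta> = K * (2 * w powr \<beta>) + 2 * w powr \<beta>"
    by (simp add: algebra_simps)
  moreover have "0 \<le> w powr \<beta>" by simp
  ultimately have "K * (1 + w) powr \<beta> \<le> w + \<alpha> / \<beta>" using ratio by linarith
  then have "K \<le> w_shape w" unfolding w_shape_def using w by (simp add: field_simps)
  then show ?thesis using w that[of w] by simp
qed

lemma w_shape_root:
  assumes "\<alpha> / \<beta> < K" and "\<beta> = 1 \<longrightarrow> K < 1"
  obtains w where "0 < w" "w_shape w = K"
proof -
  obtain b where b: "0 \<le> b" "K \<le> w_shape b"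
    using w_shape_unbounded[of K] assms ratio by force
  have "continuous_on {0..b} w_shape"
    unfolding w_shape_def by (intro continuous_intros) auto
  moreover have w0: "w_shape 0 = \<alpha> / \<beta>" by (simp add: w_shape_def)
  ultimately obtain w where "0 \<le> w" "w_shape w = K"
    using IVT'[of w_shape 0 K b] b assms by auto
  then show ?thesis using that[of w] w0 assms by (cases "w = 0") auto
qed

lemma x2_eq_iff:
  assumes m: "m > 0" and x: "x > 0"
  shows "c_fac \<alpha> \<beta> k * (x powr (- 1 / \<beta>) + m * \<alpha> / \<beta>)
          - k * m * (x powr (- 1 / \<beta>) + m) powr \<beta> = 0
     \<longleftrightarrow> w_shape (x powr (- 1 / \<beta>) / m) = k * m powr \<beta> / c_fac \<alpha> \<beta> k"
proof -
  define w where "w = x powr (- 1 / \<beta>) / m"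
  have w: "w > 0" using assms by (simp add: w_def)
  have xw: "x powr (- 1 / \<beta>) = m * w" using m by (simp add: w_def)
  have "m * w + m = m * (1 + w)" by (simp add: algebra_simps)
  then have "(m * w + m) powr \<beta> = m powr \<beta> * (1 + w) powr \<beta>"
    using m w by (simp add: powr_mult)
  then have "c_fac \<alpha> \<beta> k * (m * w + m * \<alpha> / \<beta>) - k * m * (m * w + m) powr \<beta>
     = m * (c_fac \<alpha> \<beta> k * (w + \<alpha> / \<beta>) - k * m powr \<beta> * (1 + w) powr \<beta>)"
    by (simp add: algebra_simps)
  moreover have "w_shape w = k * m powr \<beta> / c_fac \<alpha> \<beta> k
     \<longleftrightarrow> c_fac \<alpha> \<beta> k * (w + \<alpha> / \<beta>) - k * m powr \<beta> * (1 + w) powr \<beta> = 0"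
  proof -
    have "(1 + w) powr \<beta> > 0" using w by simp
    then show ?thesis
      unfolding w_shape_def using c_fac_pos by (simp add: frac_eq_eq mult_ac)
  qed
  ultimately show ?thesis using m unfolding xw by simp
qed

lemma p2_star_root:
  assumes pos: "l > 0" "g > 0" and def: "p2_defined \<alpha> \<beta> k l g P R"
  obtains w where "w > 0" "w_shape w = k * (l / g) powr \<beta> / c_fac \<alpha> \<beta> k"
    "p2_star \<alpha> \<beta> k l g P R = (R + P) / (l * w)"
proof -
  define m K where "m = l / g" and "K = k * m powr \<beta> / c_fac \<alpha> \<beta> k"
  have m: "m > 0" using pos by (simp add: m_def)
  \<comment> \<open>The conditions of case (2)(a) on l/\<gamma> place K in the range of
    \<open>w_shape\<close>: failure of case (1) means K > \<alpha>/\<beta>, the value at 0, and the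
    clause for \<beta> = 1 means K < 1.\<close>
  have "\<not> k \<le> bratio m"
    using def threshold_iff[OF m] by (simp add: p2_defined_def case2a_def m_def)
  then have "\<alpha> / \<beta> < K"
    using m c_fac_pos beta_pos by (simp add: bratio_def K_def field_simps)
  moreover have "K < 1" if "\<beta> = 1"
  proof -
    have "m < c_fac \<alpha> \<beta> k / k"
      using def that c_const_gt_1 by (auto simp: p2_defined_def case2a_def m_def c_fac_def)
    then show ?thesis using that m k c_fac_pos by (simp add: K_def field_simps)
  qed
  ultimately obtain w where w: "0 < w" "w_shape w = K" using w_shape_root by blast
  define Q where "Q x \<longleftrightarrow> x > 0 \<and> c_fac \<alpha> \<beta> k * (x powr (- 1 / \<beta>) + l * \<alpha> / (g * \<beta>))
          - k * l / g * (x powr (- 1 / \<beta>) + l / g) powr \<beta> = 0" for x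
  have Q: "Q x \<longleftrightarrow> x > 0 \<and> w_shape (x powr (- 1 / \<beta>) / m) = K" for x
    unfolding Q_def K_def using x2_eq_iff[OF m, of x] by (auto simp: m_def)
  \<comment> \<open>Inverts the substitution w = \<open>x powr (- 1 / \<beta>) / m\<close>.\<close>
  define x where "x = (1 / (m * w)) powr \<beta>"
  have x0: "x > 0" using m w by (simp add: x_def)
  have x1: "x powr (1 / \<beta>) = 1 / (m * w)" using m w beta_pos by (simp add: x_def powr_powr)
  have inv: "y powr (- 1 / \<beta>) = 1 / y powr (1 / \<beta>)" for y :: real
    using powr_minus_divide[of y "1 / \<beta>"] by simp
  have "(THE x. Q x) = x"
  proof (rule the_equality)
    show "Q x" using x0 x1 w m by (simp add: Q inv[unfolded minus_divide_left[symmetric]])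
  next
    fix y assume "Q y"
    then have y: "y > 0" "w_shape (y powr (- 1 / \<beta>) / m) = K" by (auto simp: Q)
    have "0 < y powr (- 1 / \<beta>) / m" using y m by simp
    then have "y powr (- 1 / \<beta>) / m = w"
      using w_shape_strict_mono[of w "y powr (- 1 / \<beta>) / m"]
        w_shape_strict_mono[of "y powr (- 1 / \<beta>) / m" w] w y
      by (cases "y powr (- 1 / \<beta>) / m" w rule: linorder_cases) auto
    then have "y powr (- 1 / \<beta>) = m * w" using m by (simp add: divide_eq_eq mult.commute)
    then have mw: "m * w = 1 / y powr (1 / \<beta>)" by (simp only: inv)
    have "y powr (1 / \<beta>) = 1 / (m * w)" unfolding mw by simp
    then have "(y powr (1 / \<beta>)) powr \<beta> = x" by (simp add: x_def)
    then show "y = x" using y beta_pos by (simp add: powr_powr)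
  qed
  then have "x2_star \<alpha> \<beta> k l g = x" by (simp add: x2_star_def Q_def)
  then have "p2_star \<alpha> \<beta> k l g P R = (R + P) / (l * w)"
    using x1 pos by (simp add: p2_star_def m_def)
  then show ?thesis using that w by (simp add: K_def m_def)
qed

text \<open>Lowering l and raising \<gamma> and \<Psi> at once covers all three claims about p2. A
  smaller l/\<gamma> lowers the right-hand side of the equation for w, hence w itself, which stands
  in the denominator of p2.\<close>

lemma p2_star_mono:
  assumes pos: "0 < l'" "l' \<le> l" "0 < g" "g \<le> g'" "0 \<le> R + P" "P \<le> P'"
    and def: "p2_defined \<alpha> \<beta> k l g P R" "p2_defined \<alpha> \<beta> k l' g' P' R"
  shows "p2_star \<alpha> \<beta> k l g P R \<le> p2_star \<alpha> \<beta> k l' g' P' R"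
proof -
  have "0 < l" "0 < g'" using pos by auto
  obtain w where w: "w > 0" "w_shape w = k * (l / g) powr \<beta> / c_fac \<alpha> \<beta> k"
    "p2_star \<alpha> \<beta> k l g P R = (R + P) / (l * w)"
    using p2_star_root[OF \<open>0 < l\<close> \<open>0 < g\<close> def(1)] .
  obtain w' where w': "w' > 0" "w_shape w' = k * (l' / g') powr \<beta> / c_fac \<alpha> \<beta> k"
    "p2_star \<alpha> \<beta> k l' g' P' R = (R + P') / (l' * w')"
    using p2_star_root[OF \<open>0 < l'\<close> \<open>0 < g'\<close> def(2)] .
  have "l' / g' \<le> l / g" using pos by (intro frac_le) auto
  then have "k * (l' / g') powr \<beta> / c_fac \<alpha> \<beta> k \<le> k * (l / g) powr \<beta> / c_fac \<alpha> \<beta> k"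
    using pos k c_fac_pos beta_pos by (intro divide_right_mono mult_left_mono powr_mono2) auto
  then have "w' \<le> w" using w_shape_strict_mono[of w w'] w w' by (cases "w' \<le> w") auto
  then have "(R + P) / (l * w) \<le> (R + P') / (l' * w')"
    using pos w w' by (intro frac_le mult_mono) auto
  then show ?thesis using w w' by simp
qed

end

theorem proposition5p1:
  fixes \<alpha> \<beta> k l \<gamma> \<Psi> R :: real
  assumes "0 < \<alpha>" and "\<alpha> < 1" and "\<alpha> \<le> \<beta>" and "\<beta> \<le> 1"
    and "k > 1" and "R > 0"
    and "l \<ge> 1" and "0 < \<gamma>" and "\<gamma> \<le> 1" and "\<Psi> \<ge> 0"
  shows "antimono_on {g. 0 < g \<and> g \<le> 1 \<and> p1_defined \<alpha> \<beta> k l g \<Psi> R}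
           (\<lambda>g. p1_star \<alpha> \<beta> k l g \<Psi> R)
       \<and> mono_on {P. P \<ge> 0 \<and> p1_defined \<alpha> \<beta> k l \<gamma> P R}
           (\<lambda>P. p1_star \<alpha> \<beta> k l \<gamma> P R)
       \<and> antimono_on {m. m \<ge> 1 \<and> p2_defined \<alpha> \<beta> k m \<gamma> \<Psi> R}
           (\<lambda>m. p2_star \<alpha> \<beta> k m \<gamma> \<Psi> R)
       \<and> mono_on {g. 0 < g \<and> g \<le> 1 \<and> p2_defined \<alpha> \<beta> k l g \<Psi> R}
           (\<lambda>g. p2_star \<alpha> \<beta> k l g \<Psi> R)
       \<and> mono_on {P. P \<ge> 0 \<and> p2_defined \<alpha> \<beta> k l \<gamma> P R}
           (\<lambda>P. p2_star \<alpha> \<beta> k l \<gamma> P R)"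
proof -
  interpret trader \<alpha> \<beta> k
    using assms by unfold_locales
  show ?thesis
    using assms
    by (intro conjI monotone_onI)
       (auto intro!: p1_star_antimono_gamma p1_star_mono_Psi p2_star_mono)
qed

end
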